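(* Let $S=(a_1,a_2,\dots)$ be a non-decreasing sequence of positive integers and let $K_{m,n}$, $1\leq m\leq n$, be a complete bipartite graph. If $m<n$, let $D=\frac{n}{n-m}$. Then the following holds. (1) If $a_1=a_2=\cdots=a_p=1$ and $a_{p+1}\geq 2$, where $1\leq p\leq n+1$, then $$\chi_S''(K_{m,n})=\begin{cases} 2m+m^2-p(m-1), & m=n,\\ m+n+mn-p(n-1), & m<n \text{ and } p\leq D,\\ m+mn-p(m-1), & m<n \text{ and } p>D.\end{cases}$$ (2) If $a_1\geq 2$, then $\chi_S''(K_{m,n})=m+n+mn$.
   Context: All graphs are simple and undirected. $K_{m,n}$ is the complete bipartite graph whose partite sets have sizes $m$ and $n$. For vertices $u,v$ of a graph $G$, $d(u,v)$ is the usual shortest-path distance. For a vertex $u$ and an edge $ab$, $d(u,ab)=d(ab,u)=\min\{d(u,a),d(u,b)\}+1$. For two distinct edges $ab,cd$, $d(ab,cd)=\min\{d(a,c),d(a,d),d(b,c),d(b,d)\}+1$. For a non-decreasing infinite sequence $S=(a_1,a_2,\ldots)$ of positive integers, an $S$-packing total coloring of $G$ using $k$ colors is a map $c:V(G)\cup E(G)\to\{1,\ldots,k\}$ such that any two distinct elements $A,B\in V(G)\cup E(G)$ with $c(A)=c(B)=i$ satisfy $d(A,B)>a_i$. The $S$-packing total chromatic number $\chi_S''(G)$ is the smallest $k$ for which one exists. *)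

theory Defs
  imports Complex_Main "HOL-Library.Extended_Nat"
begin

text \<open>A graph is given by its vertex set \<open>V\<close> and its set \<open>E\<close> of edges, an edge being
  the two-element set of its endpoints.\<close>

definition simple_graph :: "'a set \<Rightarrow> 'a set set \<Rightarrow> bool" where
  "simple_graph V E \<longleftrightarrow> (\<forall>e\<in>E. e \<subseteq> V \<and> card e = 2)"

definition complete_bipartite :: "'a set \<Rightarrow> 'a set set \<Rightarrow> nat \<Rightarrow> nat \<Rightarrow> bool" where
  "complete_bipartite V E m n \<longleftrightarrow>
     (\<exists>X Y. finite X \<and> finite Y \<and> card X = m \<and> card Y = n \<and> X \<inter> Y = {} \<and>
            V = X \<union> Y \<and> E = {{x, y} | x y. x \<in> X \<and> y \<in> Y})"

definition is_path :: "'a set \<Rightarrow> 'a set set \<Rightarrow> 'a \<Rightarrow> 'a list \<Rightarrow> 'a \<Rightarrow> bool" where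
  "is_path V E u xs v \<longleftrightarrow>
     xs \<noteq> [] \<and> hd xs = u \<and> last xs = v \<and> set xs \<subseteq> V \<and> distinct xs \<and>
     successively (\<lambda>x y. {x, y} \<in> E) xs"

text \<open>The distance is \<open>\<infinity>\<close> between vertices in different components.\<close>

definition vdist :: "'a set \<Rightarrow> 'a set set \<Rightarrow> 'a \<Rightarrow> 'a \<Rightarrow> enat" where
  "vdist V E u v = (INF xs\<in>{xs. is_path V E u xs v}. enat (length xs - 1))"

text \<open>The set of elements of a graph is the disjoint union \<open>V <+> E\<close>. The last equation
  below is only meaningful for distinct edges.\<close>

fun elem_dist :: "'a set \<Rightarrow> 'a set set \<Rightarrow> 'a + 'a set \<Rightarrow> 'a + 'a set \<Rightarrow> enat" where
  "elem_dist V E (Inl u) (Inl v) = vdist V E u v"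
| "elem_dist V E (Inl u) (Inr e) = (MIN a\<in>e. vdist V E u a) + 1"
| "elem_dist V E (Inr e) (Inl u) = (MIN a\<in>e. vdist V E u a) + 1"
| "elem_dist V E (Inr e) (Inr f) = (MIN (a, b)\<in>e \<times> f. vdist V E a b) + 1"

text \<open>A sequence \<open>(a\<^sub>1, a\<^sub>2, \<dots>)\<close> is a function on \<open>nat\<close> whose value at \<open>0\<close> is irrelevant.\<close>

definition packing_seq :: "(nat \<Rightarrow> nat) \<Rightarrow> bool" where
  "packing_seq a \<longleftrightarrow> (\<forall>i\<ge>1. a i > 0) \<and> mono_on {1..} a"

definition packing_total_coloring ::
    "(nat \<Rightarrow> nat) \<Rightarrow> 'a set \<Rightarrow> 'a set set \<Rightarrow> nat \<Rightarrow> ('a + 'a set \<Rightarrow> nat) \<Rightarrow> bool" where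
  "packing_total_coloring a V E k c \<longleftrightarrow>
     c ` (V <+> E) \<subseteq> {1..k} \<and>
     (\<forall>A\<in>V <+> E. \<forall>B\<in>V <+> E. A \<noteq> B \<and> c A = c B \<longrightarrow> elem_dist V E A B > enat (a (c A)))"

definition packing_total_chromatic_number ::
    "(nat \<Rightarrow> nat) \<Rightarrow> 'a set \<Rightarrow> 'a set set \<Rightarrow> nat" where
  "packing_total_chromatic_number a V E = (LEAST k. \<exists>c. packing_total_coloring a V E k c)"

lemma complete_bipartite_simple_graph:
  assumes "complete_bipartite V E m n"
  shows "simple_graph V E"
  using assms by (fastforce simp: complete_bipartite_def simple_graph_def card_2_iff)

text \<open>For finite graphs the \<open>LEAST\<close> above ranges over a nonempty set.\<close>

lemma packing_total_coloring_exists: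
  assumes "finite V" "finite E"
  shows "\<exists>c. packing_total_coloring a V E (card (V <+> E)) c"
proof -
  obtain c where c: "bij_betw c (V <+> E) {1..card (V <+> E)}"
    using assms by (metis card_atLeastAtMost diff_Suc_1 finite_Plus finite_atLeastAtMost
        finite_same_card_bij)
  then have "packing_total_coloring a V E (card (V <+> E)) c"
    unfolding packing_total_coloring_def bij_betw_def by (metis inj_onD order_refl)
  then show ?thesis by blast
qed

end

theory Submission
  imports Defs
begin

text \<open>
  In \<open>K\<^bsub>m,n\<^esub>\<close>, with parts \<open>X\<close> and \<open>Y\<close> of sizes \<open>m \<le> n\<close>, any two distinct elements are at
  distance 1 or 2 (\<open>elem_dist_dichotomy\<close>). So a color \<open>i\<close> with \<open>a\<^sub>i \<ge> 2\<close> is used at most once,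
  and a color with \<open>a\<^sub>i = 1\<close> is used on an independent class: a matching together with some
  vertices of a single part that the matching avoids. Minimizing the number of colors thus
  means maximizing the number of elements covered by \<open>p\<close> disjoint independent classes: if this
  maximum is \<open>B\<close>, the chromatic number is \<open>p + (m + n + m n - B)\<close>.

  Upper bound on \<open>B\<close>. The elements of a class other than its vertices in \<open>Y\<close> have distinct
  endpoints in \<open>X\<close>, so the class has at most \<open>m + t\<close> elements, where \<open>t\<close> is the number of its
  vertices in \<open>Y\<close>; it also has at most \<open>n\<close> elements (\<open>independent_class_le\<close>). The numbers \<open>t\<close> of
  disjoint classes add up to at most \<open>n\<close>, hence \<open>B \<le> min (p n) (p m + n)\<close>. For \<open>m < n\<close> the first
  term is the minimum exactly when \<open>p \<le> D = n / (n - m)\<close>; for \<open>m = n\<close> it always is.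

  Both bounds are attained by a cyclic construction (\<open>shifted_classes\<close>). Number the vertices and
  put \<open>d = n - m\<close>. The matching with shift \<open>i\<close> joins \<open>x\<^sub>j\<close> to \<open>y\<close> with index \<open>i + d + j\<close>
  modulo \<open>n\<close>. Distinct shifts give disjoint matchings with \<open>m\<close> edges, and the matching with shift
  \<open>i\<close> avoids the \<open>d\<close> cyclically consecutive vertices from \<open>y\<^sub>i\<close> on, which may therefore join its
  class. With the shifts \<open>0, d, 2 d, \<dots>\<close> these blocks of vertices are disjoint, so either all \<open>p\<close>
  blocks fit into \<open>Y\<close> and every class has \<open>n\<close> elements, or the blocks use up all of \<open>Y\<close>. As there
  are only \<open>n\<close> shifts, for \<open>p = n + 1\<close> the part \<open>X\<close> serves as the last class.
\<close>

section \<open>Distances in complete bipartite graphs\<close>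

fun endpoints :: "'a + 'a set \<Rightarrow> 'a set" where
  "endpoints (Inl u) = {u}"
| "endpoints (Inr e) = e"

locale complete_bipartition =
  fixes X Y V :: "'a set" and E :: "'a set set"
  assumes finite_X: "finite X" and finite_Y: "finite Y"
    and X_nonempty: "X \<noteq> {}" and Y_nonempty: "Y \<noteq> {}"
    and disjoint_parts: "X \<inter> Y = {}"
    and vertices: "V = X \<union> Y"
    and edges: "E = {{x, y} | x y. x \<in> X \<and> y \<in> Y}"
begin

lemma edge_iff: "{u, v} \<in> E \<longleftrightarrow> u \<in> X \<and> v \<in> Y \<or> u \<in> Y \<and> v \<in> X"
  unfolding edges by (auto simp: doubleton_eq_iff)

lemma vdist_eq:
  assumes u: "u \<in> V" and v: "v \<in> V"
  shows "vdist V E u v = (if u = v then 0 else if {u, v} \<in> E then 1 else 2)"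
proof -
  have upper: "vdist V E u v \<le> enat (length xs - 1)" if "is_path V E u xs v" for xs
    unfolding vdist_def using that by (auto intro: INF_lower)
  have lower: "k \<le> vdist V E u v" if "\<And>xs. is_path V E u xs v \<Longrightarrow> k \<le> enat (length xs - 1)" for k
    unfolding vdist_def using that by (auto intro: INF_greatest)
  consider "u = v" | "u \<noteq> v" "{u, v} \<in> E" | "u \<noteq> v" "{u, v} \<notin> E" by blast
  then show ?thesis
  proof cases
    case 1
    then have "is_path V E u [u] v" using u by (simp add: is_path_def)
    from upper[OF this] show ?thesis using 1 by (simp add: zero_enat_def[symmetric])
  next
    case 2
    then have "is_path V E u [u, v] v" using u v by (simp add: is_path_def)
    from upper[OF this] have "vdist V E u v \<le> 1" by (simp add: one_enat_def)
    moreover have "1 \<le> vdist V E u v"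
    proof (rule lower)
      fix xs assume "is_path V E u xs v"
      with 2 show "1 \<le> enat (length xs - 1)"
        by (cases xs rule: remdups_adj.cases) (auto simp: is_path_def one_enat_def)
    qed
    ultimately show ?thesis using 2 by simp
  next
    case 3
    then have "\<exists>w. w \<in> V \<and> w \<noteq> u \<and> w \<noteq> v \<and> {u, w} \<in> E \<and> {w, v} \<in> E"
      using u v X_nonempty Y_nonempty disjoint_parts unfolding vertices edge_iff by blast
    then obtain w where w: "w \<in> V" "w \<noteq> u" "w \<noteq> v" "{u, w} \<in> E" "{w, v} \<in> E" by blast
    then have "is_path V E u [u, w, v] v" using 3 u v by (simp add: is_path_def)
    from upper[OF this] have "vdist V E u v \<le> 2" by (simp add: numeral_eq_enat numeral_2_eq_2)
    moreover have "2 \<le> vdist V E u v"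
    proof (rule lower)
      fix xs assume p: "is_path V E u xs v"
      show "2 \<le> enat (length xs - 1)"
      proof (cases xs rule: remdups_adj.cases)
        case (3 a b zs)
        then show ?thesis using p \<open>{u, v} \<notin> E\<close>
          by (cases zs) (auto simp: is_path_def numeral_eq_enat)
      qed (use p 3 in \<open>auto simp: is_path_def\<close>)
    qed
    ultimately show ?thesis using 3 by simp
  qed
qed

lemma elem_cases:
  assumes "A \<in> V <+> E"
  obtains x where "A = Inl x" "x \<in> X" | y where "A = Inl y" "y \<in> Y"
  | x y where "A = Inr {x, y}" "x \<in> X" "y \<in> Y"
  using assms unfolding vertices edges by auto

text \<open>
  An edge contributes 1 to its distance to another element, so that distance is 1 if a common
  endpoint exists. Otherwise, of two non-incident elements at least one of which is an edge, some
  endpoint of one is adjacent to some endpoint of the other because the edge meets both parts;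
  the distance is then 2.
\<close>

lemma elem_dist_dichotomy:
  assumes "A \<in> V <+> E" "B \<in> V <+> E" "A \<noteq> B"
  shows "elem_dist V E A B =
    (if endpoints A \<inter> endpoints B \<noteq> {} \<or> (\<exists>u v. A = Inl u \<and> B = Inl v \<and> {u, v} \<in> E)
     then 1 else 2)"
proof -
  \<comment> \<open>Distances and adjacency depend only on the parts; tabulated this way, the nine
    combinations of kinds of elements reduce to rewriting.\<close>
  have XX: "vdist V E x x' = (if x = x' then 0 else 2)" if "x \<in> X" "x' \<in> X" for x x'
    using that disjoint_parts vertices by (subst vdist_eq) (auto simp: edge_iff)
  have YY: "vdist V E y y' = (if y = y' then 0 else 2)" if "y \<in> Y" "y' \<in> Y" for y y'
    using that disjoint_parts vertices by (subst vdist_eq) (auto simp: edge_iff)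
  have XY: "vdist V E x y = 1" "vdist V E y x = 1" if "x \<in> X" "y \<in> Y" for x y
    using that disjoint_parts vertices by (subst vdist_eq; auto simp: edge_iff)+
  have neq: "x \<noteq> y" "y \<noteq> x" if "x \<in> X" "y \<in> Y" for x y using that disjoint_parts by auto
  have E_XX: "{x, x'} \<notin> E" if "x \<in> X" "x' \<in> X" for x x'
    using that disjoint_parts by (auto simp: edge_iff)
  have E_YY: "{y, y'} \<notin> E" if "y \<in> Y" "y' \<in> Y" for y y'
    using that disjoint_parts by (auto simp: edge_iff)
  have E_XY: "{x, y} \<in> E" "{y, x} \<in> E" if "x \<in> X" "y \<in> Y" for x y
    using that by (auto simp: edge_iff)
  have prod: "{p, q} \<times> {r, s} = {(p, r), (p, s), (q, r), (q, s)}" for p q r s :: 'a by auto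
  show ?thesis
    by (rule elem_cases[OF assms(1)]; rule elem_cases[OF assms(2)]; insert assms(3))
      (auto simp: XX YY XY E_XX E_YY E_XY prod neq min_def one_add_one)
qed

lemma finite_elements: "finite (V <+> E)"
proof -
  have "E = (\<lambda>(x, y). {x, y}) ` (X \<times> Y)" by (auto simp: edges)
  then show ?thesis using finite_X finite_Y by (simp add: vertices)
qed

lemma card_elements: "card (V <+> E) = card X + card Y + card X * card Y"
proof -
  have E: "E = (\<lambda>(x, y). {x, y}) ` (X \<times> Y)" by (auto simp: edges)
  have "inj_on (\<lambda>(x, y). {x, y}) (X \<times> Y)"
    using disjoint_parts by (auto simp: inj_on_def doubleton_eq_iff)
  then have "card E = card X * card Y"
    unfolding E by (simp add: card_image card_cartesian_product)
  moreover have "card V = card X + card Y"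
    unfolding vertices using finite_X finite_Y disjoint_parts by (rule card_Un_disjoint)
  ultimately show ?thesis using finite_elements by (simp add: card_Plus finite_Plus_iff)
qed

section \<open>Sizes of color classes\<close>

text \<open>
  Elements of an independent class have pairwise disjoint endpoint sets, so choosing for each of
  them an endpoint in \<open>Z\<close> is injective.
\<close>

lemma independent_class_le_transversal:
  assumes "C \<subseteq> V <+> E" "finite Z"
    and "\<And>A B. A \<in> C \<Longrightarrow> B \<in> C \<Longrightarrow> A \<noteq> B \<Longrightarrow> 1 < elem_dist V E A B"
    and meet: "\<And>A. A \<in> C \<Longrightarrow> endpoints A \<inter> Z \<noteq> {}"
  shows "card C \<le> card Z"
proof -
  define r where "r A = (SOME z. z \<in> endpoints A \<inter> Z)" for A
  have r: "r A \<in> endpoints A \<inter> Z" if "A \<in> C" for A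
    unfolding r_def using meet[OF that] some_in_eq[of "endpoints A \<inter> Z"] by blast
  have "inj_on r C"
  proof (rule inj_onI, rule ccontr)
    fix A B assume AB: "A \<in> C" "B \<in> C" "r A = r B" "A \<noteq> B"
    then have "endpoints A \<inter> endpoints B \<noteq> {}" using r[of A] r[of B] by auto
    then have "elem_dist V E A B = 1" using elem_dist_dichotomy[of A B] AB assms(1) by auto
    with assms(3)[OF AB(1,2,4)] show False by simp
  qed
  moreover have "r ` C \<subseteq> Z" using r by blast
  ultimately show ?thesis using card_inj_on_le assms(2) by blast
qed

text \<open>
  Every element except a vertex of \<open>Y\<close> has an endpoint in \<open>X\<close>, which gives the first bound. For the
  second, a class cannot contain vertices of both parts, so all of its elements have an endpoint
  in \<open>X\<close>, or all of them have one in \<open>Y\<close>.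
\<close>

lemma independent_class_le:
  assumes C: "C \<subseteq> V <+> E"
    and indep: "\<And>A B. A \<in> C \<Longrightarrow> B \<in> C \<Longrightarrow> A \<noteq> B \<Longrightarrow> 1 < elem_dist V E A B"
  shows "card C \<le> card X + card {y \<in> Y. Inl y \<in> C}"
    and "card C \<le> max (card X) (card Y)"
proof -
  let ?T = "{y \<in> Y. Inl y \<in> C}"
  have fin: "finite C" using C finite_elements finite_subset by blast
  have meet_X: "endpoints A \<inter> X \<noteq> {}" if "A \<in> C - Inl ` ?T" for A
    using that C by (auto simp: vertices edges)
  have "card (C - Inl ` ?T) \<le> card X"
    by (rule independent_class_le_transversal) (use C indep meet_X finite_X in auto)
  moreover have "card C = card (C - Inl ` ?T) + card ?T"
  proof -
    have "card (Inl ` ?T :: ('a + 'a set) set) = card ?T" by (simp add: card_image)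
    moreover have "Inl ` ?T \<subseteq> C" by auto
    ultimately show ?thesis
      using fin card_Diff_subset[of "Inl ` ?T" C] card_mono[of C "Inl ` ?T"] finite_subset[of _ C]
      by simp
  qed
  ultimately show "card C \<le> card X + card ?T" by simp
  show "card C \<le> max (card X) (card Y)"
  proof (cases "\<exists>x\<in>X. Inl x \<in> C")
    case True
    then obtain x where x: "x \<in> X" "Inl x \<in> C" by blast
    have "Inl y \<notin> C" if y: "y \<in> Y" for y
    proof
      assume yC: "Inl y \<in> C"
      have "x \<noteq> y" "x \<in> V" "y \<in> V" using x y disjoint_parts by (auto simp: vertices)
      then have "elem_dist V E (Inl x) (Inl y) = 1"
        using x y by (simp add: vdist_eq edge_iff)
      with indep[OF x(2) yC] \<open>x \<noteq> y\<close> show False by simp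
    qed
    then have "?T = {}" by blast
    then have "endpoints A \<inter> X \<noteq> {}" if "A \<in> C" for A using meet_X that by blast
    then have "card C \<le> card X"
      by (intro independent_class_le_transversal C finite_X indep)
    then show ?thesis by simp
  next
    case False
    then have "endpoints A \<inter> Y \<noteq> {}" if "A \<in> C" for A
      using that C by (auto simp: vertices edges)
    then have "card C \<le> card Y"
      by (intro independent_class_le_transversal C finite_Y indep)
    then show ?thesis by simp
  qed
qed

lemma packing_class_card_le_1:
  assumes c: "packing_total_coloring a V E k c" and "a i \<ge> 2"
  shows "card {A \<in> V <+> E. c A = i} \<le> 1"
proof -
  have "A = B" if "A \<in> V <+> E" "B \<in> V <+> E" "c A = i" "c B = i" for A B
  proof (rule ccontr)
    assume "A \<noteq> B"
    with that c have "elem_dist V E A B > enat (a i)"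
      unfolding packing_total_coloring_def by metis
    moreover have "elem_dist V E A B \<le> 2"
      using elem_dist_dichotomy[OF that(1,2) \<open>A \<noteq> B\<close>] by (auto simp: one_enat_def numeral_eq_enat)
    ultimately have "enat (a i) < 2" by (rule less_le_trans)
    with assms(2) show False by (simp add: numeral_eq_enat)
  qed
  then show ?thesis by (intro card_le_Suc0_iff_eq[THEN iffD2, simplified One_nat_def[symmetric]])
      (use finite_elements in auto)
qed

lemma sum_color_classes:
  assumes "packing_total_coloring a V E k c"
  shows "card (V <+> E) = (\<Sum>i\<in>{1..k}. card {A \<in> V <+> E. c A = i})"
  using sum.group[of "V <+> E" "{1..k}" c "\<lambda>_. 1 :: nat"] assms finite_elements
  by (simp add: packing_total_coloring_def)

lemma chromatic_number_attained:
  obtains c where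
    "packing_total_coloring a V E (packing_total_chromatic_number a V E) c"
proof -
  have "finite V" "finite E" using finite_elements by (simp_all add: finite_Plus_iff)
  then have "\<exists>k. \<exists>c. packing_total_coloring a V E k c"
    using packing_total_coloring_exists by blast
  from LeastI_ex[OF this] show ?thesis
    using that unfolding packing_total_chromatic_number_def by blast
qed

lemma chromatic_number_le:
  assumes "packing_total_coloring a V E k c"
  shows "packing_total_chromatic_number a V E \<le> k"
  unfolding packing_total_chromatic_number_def using assms by (blast intro: Least_le)

section \<open>Lower bounds\<close>

text \<open>
  The colors after \<open>p\<close> contribute at most one element each, and the first \<open>p\<close> classes are bounded
  in the two ways of \<open>independent_class_le\<close>; the two bounds are the two terms of
  \<open>min (p n) (p m + n)\<close>.
\<close>

lemma chromatic_number_lower_bounds: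
  assumes "card X \<le> card Y"
    and pos: "\<And>i. i \<ge> 1 \<Longrightarrow> a i \<ge> 1" and large: "\<And>i. i > p \<Longrightarrow> a i \<ge> 2"
    and "p \<le> card Y + 1"
  shows "card (V <+> E) + p \<le> packing_total_chromatic_number a V E + p * card Y"
    and "card (V <+> E) + p \<le> packing_total_chromatic_number a V E + p * card X + card Y"
proof -
  define k where "k = packing_total_chromatic_number a V E"
  obtain c where c: "packing_total_coloring a V E k c"
    using chromatic_number_attained unfolding k_def by blast
  define K where "K i = {A \<in> V <+> E. c A = i}" for i
  have indep: "1 < elem_dist V E A B" if "i \<ge> 1" "A \<in> K i" "B \<in> K i" "A \<noteq> B" for i A B
  proof -
    have "enat (a i) < elem_dist V E A B"
    proof -
      have "A \<in> V <+> E" "B \<in> V <+> E" "c A = i" "c B = i"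
        using that unfolding K_def by blast+
      with c that(4) show ?thesis unfolding packing_total_coloring_def by metis
    qed
    moreover have "1 \<le> enat (a i)" using pos[OF that(1)] by (simp add: one_enat_def)
    ultimately show ?thesis by (rule le_less_trans[rotated])
  qed
  have K_sub: "K i \<subseteq> V <+> E" for i by (auto simp: K_def)
  have K_Y: "card (K i) \<le> card Y" if "i \<ge> 1" for i
    using independent_class_le(2)[OF K_sub indep[OF that]] assms(1) by simp
  have K_X: "card (K i) \<le> card X + card {y \<in> Y. c (Inl y) = i}" if "i \<ge> 1" for i
  proof -
    have "{y \<in> Y. Inl y \<in> K i} = {y \<in> Y. c (Inl y) = i}" by (auto simp: K_def vertices)
    moreover have "card (K i) \<le> card X + card {y \<in> Y. Inl y \<in> K i}"
      by (rule independent_class_le(1)[OF K_sub indep[OF that]])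
    ultimately show ?thesis by simp
  qed
  have bound_Y: "(\<Sum>i\<in>{1..q}. card (K i)) \<le> q * card Y" for q
    using sum_bounded_above[of "{1..q}" "\<lambda>i. card (K i)" "card Y"] K_Y by simp
  have bound_X: "(\<Sum>i\<in>{1..q}. card (K i)) \<le> q * card X + card Y" for q
  proof -
    have "(\<Sum>i\<in>{1..q}. card {y \<in> Y. c (Inl y) = i}) = card (\<Union>i\<in>{1..q}. {y \<in> Y. c (Inl y) = i})"
      by (rule card_UN_disjoint[symmetric]) (use finite_Y in auto)
    also have "\<dots> \<le> card Y" using finite_Y by (intro card_mono) auto
    finally have "(\<Sum>i\<in>{1..q}. card X + card {y \<in> Y. c (Inl y) = i}) \<le> q * card X + card Y"
      by (simp add: sum.distrib)
    moreover have "(\<Sum>i\<in>{1..q}. card (K i)) \<le> (\<Sum>i\<in>{1..q}. card X + card {y \<in> Y. c (Inl y) = i})"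
      using K_X by (intro sum_mono) auto
    ultimately show ?thesis by simp
  qed
  have total: "card (V <+> E) = (\<Sum>i\<in>{1..k}. card (K i))"
    using sum_color_classes[OF c] by (simp add: K_def)
  \<comment> \<open>At most \<open>n\<close> independent classes cover at most \<open>n m + n\<close> elements, which misses at least \<open>m\<close>.\<close>
  have "p \<le> k"
  proof (rule ccontr)
    assume "\<not> p \<le> k"
    then have "k \<le> card Y" using assms(4) by simp
    then have "k * card X \<le> card X * card Y" by (metis mult.commute mult_le_mono2)
    then have "card (V <+> E) \<le> card X * card Y + card Y" using total bound_X[of k] by linarith
    moreover have "card X > 0" using finite_X X_nonempty by (simp add: card_gt_0_iff)
    ultimately show False by (simp add: card_elements)
  qed
  have "card (V <+> E) = (\<Sum>i\<in>{1..p}. card (K i)) + (\<Sum>i\<in>{p+1..k}. card (K i))"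
    using total \<open>p \<le> k\<close> sum.ub_add_nat[of 1 p "\<lambda>i. card (K i)" "k - p"] by simp
  moreover have "(\<Sum>i\<in>{p+1..k}. card (K i)) \<le> k - p"
    using sum_bounded_above[of "{p+1..k}" "\<lambda>i. card (K i)" 1]
      packing_class_card_le_1[OF c large] by (simp add: K_def)
  ultimately have "card (V <+> E) + p \<le> k + (\<Sum>i\<in>{1..p}. card (K i))"
    using \<open>p \<le> k\<close> by simp
  then show "card (V <+> E) + p \<le> packing_total_chromatic_number a V E + p * card Y"
    and "card (V <+> E) + p \<le> packing_total_chromatic_number a V E + p * card X + card Y"
    using bound_Y[of p] bound_X[of p] by (simp_all add: k_def)
qed

section \<open>Colorings from disjoint independent classes\<close>

text \<open>
  Each class receives one of the colors \<open>i\<close> with \<open>a\<^sub>i = 1\<close>, and each of the remaining elements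
  receives a new color of its own.
\<close>

lemma chromatic_number_le_disjoint_classes:
  assumes ones: "\<And>i. i \<in> {1..card J} \<Longrightarrow> a i = 1" and "finite J"
    and sub: "\<And>i. i \<in> J \<Longrightarrow> C i \<subseteq> V <+> E"
    and indep: "\<And>i A B. i \<in> J \<Longrightarrow> A \<in> C i \<Longrightarrow> B \<in> C i \<Longrightarrow> A \<noteq> B \<Longrightarrow> 1 < elem_dist V E A B"
    and disj: "\<And>i j. i \<in> J \<Longrightarrow> j \<in> J \<Longrightarrow> i \<noteq> j \<Longrightarrow> C i \<inter> C j = {}"
  shows "packing_total_chromatic_number a V E + (\<Sum>i\<in>J. card (C i)) \<le> card J + card (V <+> E)"
proof -
  define W where "W = (\<Union>i\<in>J. C i)"
  define R where "R = (V <+> E) - W"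
  have W_sub: "W \<subseteq> V <+> E" using sub by (auto simp: W_def)
  have "finite W" using W_sub finite_elements finite_subset by blast
  have "finite (C i)" if "i \<in> J" for i using sub[OF that] finite_elements finite_subset by blast
  then have "card W = (\<Sum>i\<in>J. card (C i))"
    unfolding W_def by (intro card_UN_disjoint) (simp_all add: \<open>finite J\<close> disj)
  then have card_R: "(\<Sum>i\<in>J. card (C i)) + card R = card (V <+> E)"
    using card_Diff_subset[OF \<open>finite W\<close> W_sub] card_mono[OF finite_elements W_sub]
    by (simp add: R_def)
  obtain g where g: "bij_betw g J {1..card J}"
    using finite_same_card_bij[of J "{1..card J}"] \<open>finite J\<close> by auto
  obtain h where h: "bij_betw h R {card J + 1..card J + card R}"
    using finite_same_card_bij[of R "{card J + 1..card J + card R}"] finite_elements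
    by (auto simp: R_def)
  have "\<forall>A\<in>W. \<exists>i. i \<in> J \<and> A \<in> C i" by (auto simp: W_def)
  then obtain cls where cls: "\<And>A. A \<in> W \<Longrightarrow> cls A \<in> J \<and> A \<in> C (cls A)" by metis
  define c where "c A = (if A \<in> W then g (cls A) else h A)" for A
  have c_W: "c A \<in> {1..card J}" if "A \<in> W" for A
    using that cls bij_betwE[OF g] by (auto simp: c_def)
  have c_R: "c A \<in> {card J + 1..card J + card R}" if "A \<in> V <+> E" "A \<notin> W" for A
  proof -
    have "A \<in> R" using that unfolding R_def by blast
    then show ?thesis using bij_betwE[OF h] that by (auto simp: c_def)
  qed
  have "packing_total_coloring a V E (card J + card R) c"
    unfolding packing_total_coloring_def
  proof (intro conjI ballI impI)
    show "c ` (V <+> E) \<subseteq> {1..card J + card R}"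
    proof (rule image_subsetI)
      fix A assume "A \<in> V <+> E"
      then show "c A \<in> {1..card J + card R}" using c_W[of A] c_R[of A] by (cases "A \<in> W") auto
    qed
  next
    fix A B assume A: "A \<in> V <+> E" and B: "B \<in> V <+> E" and AB: "A \<noteq> B \<and> c A = c B"
    consider "A \<in> W" "B \<in> W" | "A \<notin> W" "B \<notin> W"
      using c_W[of A] c_W[of B] c_R[OF A] c_R[OF B] AB by fastforce
    then show "enat (a (c A)) < elem_dist V E A B"
    proof cases
      case 1
      then have "cls A = cls B"
        using AB cls bij_betw_imp_inj_on[OF g] by (auto simp: c_def dest: inj_onD)
      then have "1 < elem_dist V E A B" using cls[of A] cls[of B] 1 indep AB by metis
      moreover have "a (c A) = 1" using ones c_W 1 by blast
      ultimately show ?thesis by (simp add: one_enat_def)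
    next
      case 2
      then have "A \<in> R" "B \<in> R" using A B unfolding R_def by blast+
      then have "A = B"
        using 2 AB bij_betw_imp_inj_on[OF h] by (auto simp: c_def dest: inj_onD)
      then show ?thesis using AB by simp
    qed
  qed
  from chromatic_number_le[OF this] show ?thesis using card_R by simp
qed

text \<open>
  The class of the shift \<open>i\<close> consists of a cyclic matching that saturates \<open>X\<close> and of those vertices
  \<open>y\<^sub>l\<close> with \<open>l \<in> L\<close> and \<open>h l = i\<close>. The matching uses the indices \<open>i + t\<close> modulo \<open>n\<close> with
  \<open>d \<le> t < n\<close>, where \<open>d = n - m\<close>, while the condition on \<open>h\<close> puts \<open>l\<close> into the window
  \<open>i, \<dots>, i + d - 1\<close>; so the matching avoids the added vertices. The classes contain no vertex of
  \<open>X\<close>, which leaves that part available as a further class.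
\<close>

lemma shifted_classes:
  assumes "card X \<le> card Y" and I: "I \<subseteq> {..<card Y}" and L: "L \<subseteq> {..<card Y}"
    and h: "\<And>l. l \<in> L \<Longrightarrow> h l \<in> I \<and> h l \<le> l \<and> l < h l + (card Y - card X)"
  obtains C where "\<And>i. i \<in> I \<Longrightarrow> C i \<subseteq> (V <+> E) - Inl ` X"
    and "\<And>i A B. i \<in> I \<Longrightarrow> A \<in> C i \<Longrightarrow> B \<in> C i \<Longrightarrow> A \<noteq> B \<Longrightarrow> 1 < elem_dist V E A B"
    and "\<And>i j. i \<in> I \<Longrightarrow> j \<in> I \<Longrightarrow> i \<noteq> j \<Longrightarrow> C i \<inter> C j = {}"
    and "(\<Sum>i\<in>I. card (C i)) = card I * card X + card L"
proof -
  define m n where "m = card X" and "n = card Y"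
  define d where "d = n - m"
  have dm: "d + m = n" using assms(1) by (simp add: d_def m_def n_def)
  obtain x where "bij_betw x {0..<card X} X" using ex_bij_betw_nat_finite[OF finite_X] by blast
  then have x: "bij_betw x {..<m} X" by (simp add: m_def lessThan_atLeast0)
  obtain y where "bij_betw y {0..<card Y} Y" using ex_bij_betw_nat_finite[OF finite_Y] by blast
  then have y: "bij_betw y {..<n} Y" by (simp add: n_def lessThan_atLeast0)
  have n_pos: "n > 0" using finite_Y Y_nonempty by (simp add: n_def card_gt_0_iff)
  have xX: "x j \<in> X" if "j < m" for j using bij_betwE[OF x] that by simp
  have yY: "y l \<in> Y" if "l < n" for l using bij_betwE[OF y] that by simp
  have x_eq: "x j = x j' \<longleftrightarrow> j = j'" if "j < m" "j' < m" for j j'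
    using inj_on_eq_iff[OF bij_betw_imp_inj_on[OF x]] that by simp
  have y_eq: "y l = y l' \<longleftrightarrow> l = l'" if "l < n" "l' < n" for l l'
    using inj_on_eq_iff[OF bij_betw_imp_inj_on[OF y]] that by simp
  have xy: "x j \<noteq> y l" "y l \<noteq> x j" if "j < m" "l < n" for j l
    using xX[OF that(1)] yY[OF that(2)] disjoint_parts by auto
  have mod_inj: "t = t'" if "(i + t) mod n = (i + t') mod n" "i < n" "t < n" "t' < n" for i t t'
  proof -
    have "(i + s) mod n = (if i + s < n then i + s else i + s - n)" if "s < n" for s
      using that \<open>i < n\<close> by (simp add: mod_if)
    then show ?thesis using that by (auto split: if_splits)
  qed
  define partner where "partner i j = (i + (d + j)) mod n" for i j
  have partner_lt: "partner i j < n" for i j using n_pos by (simp add: partner_def)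
  have partner_eq: "partner i j = partner i j' \<longleftrightarrow> j = j'" if "i < n" "j < m" "j' < m" for i j j'
    using mod_inj[of i "d + j" "d + j'"] that dm by (auto simp: partner_def)
  have partner_eq': "partner i j = partner i' j \<longleftrightarrow> i = i'" if "i < n" "i' < n" "j < m" for i i' j
    using mod_inj[of "d + j" i i'] that dm by (auto simp: partner_def add.commute)
  have partner_free: "partner (h l) j \<noteq> l" if "l \<in> L" "j < m" for l j
  proof
    assume eq: "partner (h l) j = l"
    have l: "h l < n" "h l \<le> l" "l < h l + d" "l < n"
      using h[OF that(1)] I L that(1) by (auto simp: d_def m_def n_def)
    have "(h l + (d + j)) mod n = (h l + (l - h l)) mod n" using eq l by (simp add: partner_def)
    from mod_inj[OF this] have "d + j = l - h l" using l that dm by simp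
    with l show False by simp
  qed
  define M :: "nat \<Rightarrow> ('a + 'a set) set" where "M i = (\<lambda>j. Inr {x j, y (partner i j)}) ` {..<m}" for i
  define T where "T i = {l \<in> L. h l = i}" for i
  define C :: "nat \<Rightarrow> ('a + 'a set) set" where "C i = M i \<union> (Inl \<circ> y) ` T i" for i
  have I_lt: "i < n" if "i \<in> I" for i using I that by (auto simp: n_def)
  have L_lt: "l < n" if "l \<in> L" for l using L that by (auto simp: n_def)
  have "C i \<subseteq> V <+> E" for i
    using xX yY partner_lt L_lt unfolding C_def M_def T_def
    by (auto simp: vertices edge_iff)
  moreover have "C i \<inter> Inl ` X = {}" for i
    using yY L_lt disjoint_parts unfolding C_def M_def T_def by auto
  ultimately have sub: "C i \<subseteq> (V <+> E) - Inl ` X" for i by blast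
  have C_cases: thesis if "A \<in> C i"
    "\<And>j. j < m \<Longrightarrow> A = Inr {x j, y (partner i j)} \<Longrightarrow> thesis"
    "\<And>l. l \<in> L \<Longrightarrow> h l = i \<Longrightarrow> A = Inl (y l) \<Longrightarrow> thesis" for A i thesis
    using that unfolding C_def M_def T_def by auto
  have indep: "1 < elem_dist V E A B" if i: "i \<in> I" and A: "A \<in> C i" and B: "B \<in> C i" and "A \<noteq> B"
    for i A B
  proof -
    have YY: "{y l, y l'} \<notin> E" if "l \<in> L" "l' \<in> L" for l l'
      using yY[OF L_lt] that disjoint_parts unfolding edge_iff by blast
    have "endpoints A \<inter> endpoints B = {} \<and> \<not> (\<exists>u v. A = Inl u \<and> B = Inl v \<and> {u, v} \<in> E)"
    proof (rule C_cases[OF A]; rule C_cases[OF B])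
      fix j j' assume j: "j < m" "A = Inr {x j, y (partner i j)}"
        "j' < m" "B = Inr {x j', y (partner i j')}"
      then have "j \<noteq> j'" using \<open>A \<noteq> B\<close> by auto
      with j I_lt[OF i] show ?thesis by (simp add: x_eq y_eq xy partner_eq partner_lt)
    next
      fix j l assume "j < m" "A = Inr {x j, y (partner i j)}" "l \<in> L" "h l = i" "B = Inl (y l)"
      then show ?thesis using partner_free[of l j] by (simp add: y_eq xy partner_lt L_lt)
    next
      fix l j assume "l \<in> L" "h l = i" "A = Inl (y l)" "j < m" "B = Inr {x j, y (partner i j)}"
      then show ?thesis using partner_free[of l j] by (simp add: y_eq xy partner_lt L_lt)
    next
      fix l l' assume l: "l \<in> L" "A = Inl (y l)" "l' \<in> L" "B = Inl (y l')"
      then show ?thesis using \<open>A \<noteq> B\<close> YY by auto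
    qed
    moreover have "A \<in> V <+> E" "B \<in> V <+> E" using A B sub by blast+
    ultimately show ?thesis using elem_dist_dichotomy[OF _ _ \<open>A \<noteq> B\<close>] by simp
  qed
  have disj: "C i \<inter> C i' = {}" if "i \<in> I" "i' \<in> I" "i \<noteq> i'" for i i'
  proof -
    have False if A: "A \<in> C i" and A': "A \<in> C i'" for A
    proof (rule C_cases[OF A]; rule C_cases[OF A'])
      fix j j' assume j: "j < m" "A = Inr {x j, y (partner i j)}"
        "j' < m" "A = Inr {x j', y (partner i' j')}"
      then have "{x j, y (partner i j)} = {x j', y (partner i' j')}" by simp
      then have "j = j' \<and> partner i j = partner i' j'"
        using j by (simp add: doubleton_eq_iff x_eq y_eq xy partner_lt)
      then show False using partner_eq' I_lt \<open>i \<in> I\<close> \<open>i' \<in> I\<close> \<open>i \<noteq> i'\<close> j by blast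
    next
      fix l l' assume "l \<in> L" "h l = i" "A = Inl (y l)" "l' \<in> L" "h l' = i'" "A = Inl (y l')"
      then show False using \<open>i \<noteq> i'\<close> by (simp add: y_eq L_lt)
    qed simp_all
    then show ?thesis by blast
  qed
  have card_C: "card (C i) = m + card (T i)" if "i \<in> I" for i
  proof -
    have "finite (T i)"
      by (rule finite_subset[of _ "{..<n}"]) (use L_lt in \<open>auto simp: T_def\<close>)
    have "inj_on (\<lambda>j. Inr {x j, y (partner i j)} :: 'a + 'a set) {..<m}"
      by (auto simp: inj_on_def doubleton_eq_iff x_eq xy partner_lt)
    then have "card (M i) = m" by (simp add: M_def card_image)
    moreover have "inj_on (Inl \<circ> y :: nat \<Rightarrow> 'a + 'a set) (T i)"
      by (auto simp: inj_on_def T_def y_eq L_lt)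
    then have "card ((Inl \<circ> y :: nat \<Rightarrow> 'a + 'a set) ` T i) = card (T i)" by (rule card_image)
    moreover have "M i \<inter> (Inl \<circ> y) ` T i = {}" "finite (M i)" by (auto simp: M_def)
    ultimately show ?thesis
      unfolding C_def using \<open>finite (T i)\<close> by (simp add: card_Un_disjoint)
  qed
  have "finite L" "finite I" using L I finite_subset by blast+
  then have "(\<Sum>i\<in>I. card (T i)) = card L"
    using sum.group[of L I h "\<lambda>_. 1 :: nat"] h by (auto simp: T_def)
  then have "(\<Sum>i\<in>I. card (C i)) = card I * card X + card L"
    using card_C by (simp add: sum.distrib m_def)
  from that[OF sub indep disj this] show ?thesis .
qed

lemma chromatic_number_le_shifts:
  assumes "card X \<le> card Y" and "I \<subseteq> {..<card Y}" and "L \<subseteq> {..<card Y}"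
    and "\<And>l. l \<in> L \<Longrightarrow> h l \<in> I \<and> h l \<le> l \<and> l < h l + (card Y - card X)"
    and ones: "\<And>i. i \<in> {1..card I} \<Longrightarrow> a i = 1"
  shows "packing_total_chromatic_number a V E + card I * card X + card L
    \<le> card I + card (V <+> E)"
proof -
  obtain C where C: "\<And>i. i \<in> I \<Longrightarrow> C i \<subseteq> (V <+> E) - Inl ` X"
    "\<And>i A B. i \<in> I \<Longrightarrow> A \<in> C i \<Longrightarrow> B \<in> C i \<Longrightarrow> A \<noteq> B \<Longrightarrow> 1 < elem_dist V E A B"
    "\<And>i j. i \<in> I \<Longrightarrow> j \<in> I \<Longrightarrow> i \<noteq> j \<Longrightarrow> C i \<inter> C j = {}"
    "(\<Sum>i\<in>I. card (C i)) = card I * card X + card L"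
    using shifted_classes[OF assms(1-4)] by blast
  have "finite I" using assms(2) finite_subset by blast
  have "packing_total_chromatic_number a V E + (\<Sum>i\<in>I. card (C i)) \<le> card I + card (V <+> E)"
  proof (rule chromatic_number_le_disjoint_classes)
    show "C i \<subseteq> V <+> E" if "i \<in> I" for i using C(1)[OF that] by blast
  qed (fact ones \<open>finite I\<close> C(2) C(3))+
  then show ?thesis using C(4) by simp
qed

text \<open>
  All \<open>n\<close> shifts together use every edge; the vertices of \<open>X\<close> form one more independent class.
\<close>

lemma chromatic_number_le_all_shifts:
  assumes "card X \<le> card Y" and "L \<subseteq> {..<card Y}"
    and "\<And>l. l \<in> L \<Longrightarrow> h l \<le> l \<and> l < h l + (card Y - card X)"
    and ones: "\<And>i. i \<in> {1..card Y + 1} \<Longrightarrow> a i = 1"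
  shows "packing_total_chromatic_number a V E + (card Y + 1) * card X + card L
    \<le> card Y + 1 + card (V <+> E)"
proof -
  let ?I = "{..<card Y}"
  have h: "h l \<in> ?I \<and> h l \<le> l \<and> l < h l + (card Y - card X)" if "l \<in> L" for l
    using assms(3)[OF that] assms(2) that by force
  obtain C where C: "\<And>i. i \<in> ?I \<Longrightarrow> C i \<subseteq> (V <+> E) - Inl ` X"
    "\<And>i A B. i \<in> ?I \<Longrightarrow> A \<in> C i \<Longrightarrow> B \<in> C i \<Longrightarrow> A \<noteq> B \<Longrightarrow> 1 < elem_dist V E A B"
    "\<And>i j. i \<in> ?I \<Longrightarrow> j \<in> ?I \<Longrightarrow> i \<noteq> j \<Longrightarrow> C i \<inter> C j = {}"
    "(\<Sum>i\<in>?I. card (C i)) = card ?I * card X + card L"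
    using shifted_classes[OF assms(1) order_refl assms(2) h] by blast
  define C' where "C' i = (if i < card Y then C i else Inl ` X)" for i
  let ?J = "{..<card Y + 1}"
  have X_indep: "1 < elem_dist V E A B" if "A \<in> Inl ` X" "B \<in> Inl ` X" "A \<noteq> B" for A B
  proof -
    obtain u v where "A = Inl u" "B = Inl v" "u \<in> V" "v \<in> V" "u \<noteq> v" "{u, v} \<notin> E"
      using \<open>A \<in> _\<close> \<open>B \<in> _\<close> \<open>A \<noteq> B\<close> disjoint_parts by (auto simp: edge_iff vertices)
    then show ?thesis by (simp add: vdist_eq)
  qed
  have "packing_total_chromatic_number a V E + (\<Sum>i\<in>?J. card (C' i)) \<le> card ?J + card (V <+> E)"
  proof (rule chromatic_number_le_disjoint_classes)
    show "a i = 1" if "i \<in> {1..card ?J}" for i using that ones by simp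
    show "C' i \<subseteq> V <+> E" if "i \<in> ?J" for i
      using C(1)[of i] by (auto simp: C'_def vertices)
    show "1 < elem_dist V E A B" if "i \<in> ?J" "A \<in> C' i" "B \<in> C' i" "A \<noteq> B" for i A B
      using that C(2)[of i A B] X_indep[of A B] by (auto simp: C'_def split: if_splits)
    show "C' i \<inter> C' j = {}" if "i \<in> ?J" "j \<in> ?J" "i \<noteq> j" for i j
      using that C(3)[of i j] C(1)[of i] C(1)[of j] unfolding C'_def
      by (cases "i < card Y"; cases "j < card Y") auto
  qed simp
  moreover have "(\<Sum>i\<in>?J. card (C' i)) = (card Y + 1) * card X + card L"
    using C(4) by (simp add: C'_def card_image)
  ultimately show ?thesis by simp
qed

section \<open>The chromatic number\<close>

text \<open>
  When the parts have equal size, a matching that saturates \<open>X\<close> leaves no vertex of \<open>Y\<close> free: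
  perfect matchings, followed by \<open>X\<close> if \<open>p = n + 1\<close>, already reach the bound \<open>m\<close> for each class.
\<close>

lemma chromatic_number_balanced:
  assumes "card X = card Y" and pos: "\<And>i. i \<ge> 1 \<Longrightarrow> a i \<ge> 1" and large: "\<And>i. i > p \<Longrightarrow> a i \<ge> 2"
    and ones: "\<And>i. i \<in> {1..p} \<Longrightarrow> a i = 1" and "p \<le> card Y + 1"
  shows "packing_total_chromatic_number a V E + p * card X = card (V <+> E) + p"
proof -
  have "packing_total_chromatic_number a V E + p * card X \<le> card (V <+> E) + p"
  proof (cases "p \<le> card Y")
    case True
    then show ?thesis
      using chromatic_number_le_shifts[of "{..<p}" "{}" id a] assms(1) ones by simp
  next
    case False
    then have "p = card Y + 1" using assms(5) by simp
    then show ?thesis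
      using chromatic_number_le_all_shifts[of "{}" id a] assms(1) ones by simp
  qed
  moreover have "card (V <+> E) + p \<le> packing_total_chromatic_number a V E + p * card Y"
    using chromatic_number_lower_bounds(1)[of a p] assms by simp
  ultimately show ?thesis using assms(1) by simp
qed

text \<open>
  With \<open>d = n - m\<close>, the blocks of \<open>d\<close> consecutive indices starting at \<open>0, d, \<dots>, (p - 1) d\<close> are
  disjoint and fit into \<open>Y\<close>, so that each of the \<open>p\<close> classes has the maximal size \<open>m + d = n\<close>.
\<close>

lemma chromatic_number_few_ones:
  assumes "card X < card Y" and pos: "\<And>i. i \<ge> 1 \<Longrightarrow> a i \<ge> 1"
    and large: "\<And>i. i > p \<Longrightarrow> a i \<ge> 2" and ones: "\<And>i. i \<in> {1..p} \<Longrightarrow> a i = 1"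
    and p: "p * (card Y - card X) \<le> card Y"
  shows "packing_total_chromatic_number a V E + p * card Y = card (V <+> E) + p"
proof -
  define d where "d = card Y - card X"
  have d: "d > 0" "card Y = card X + d" using assms(1) by (simp_all add: d_def)
  have pd: "p * d \<le> card Y" using p by (simp add: d_def)
  have p_le: "p \<le> card Y"
  proof -
    have "p * 1 \<le> p * d" using d(1) by (intro mult_le_mono2) simp
    with pd show ?thesis by linarith
  qed
  define I where "I = (\<lambda>q. q * d) ` {..<p}"
  have I_sub: "I \<subseteq> {..<card Y}"
  proof
    fix i assume "i \<in> I"
    then obtain q where q: "q < p" "i = q * d" by (auto simp: I_def)
    then have "i < p * d" using d by simp
    then show "i \<in> {..<card Y}" using pd by simp
  qed
  have card_I: "card I = p" using d by (simp add: I_def card_image inj_on_def)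
  have "l div d * d \<in> I \<and> l div d * d \<le> l \<and> l < l div d * d + (card Y - card X)"
    if "l \<in> {..<p * d}" for l
    using that d dividend_less_div_times[of d l]
    by (auto simp: I_def less_mult_imp_div_less add.commute)
  then have "packing_total_chromatic_number a V E + p * card X + p * d \<le> p + card (V <+> E)"
    using chromatic_number_le_shifts[of I "{..<p * d}" "\<lambda>l. l div d * d" a] assms(1) I_sub pd ones
    by (simp add: card_I)
  moreover have "card (V <+> E) + p \<le> packing_total_chromatic_number a V E + p * card Y"
    using chromatic_number_lower_bounds(1)[of a p] assms p_le by simp
  ultimately show ?thesis using d(2) by (simp add: algebra_simps)
qed

text \<open>
  The blocks starting at the multiples of \<open>d = n - m\<close> below \<open>n\<close> cover \<open>Y\<close>, and there are at most
  \<open>p\<close> of them. Further shifts, chosen arbitrarily, contribute their matchings only.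
\<close>

lemma chromatic_number_many_ones:
  assumes "card X < card Y" and pos: "\<And>i. i \<ge> 1 \<Longrightarrow> a i \<ge> 1"
    and large: "\<And>i. i > p \<Longrightarrow> a i \<ge> 2" and ones: "\<And>i. i \<in> {1..p} \<Longrightarrow> a i = 1"
    and p: "card Y < p * (card Y - card X)" and "p \<le> card Y + 1"
  shows "packing_total_chromatic_number a V E + p * card X + card Y = card (V <+> E) + p"
proof -
  define d where "d = card Y - card X"
  have d: "d > 0" using assms(1) by (simp add: d_def)
  have h: "l div d * d \<le> l \<and> l < l div d * d + (card Y - card X)" for l
    using d dividend_less_div_times[of d l] by (simp add: d_def[symmetric] add.commute)
  have "packing_total_chromatic_number a V E + p * card X + card Y \<le> card (V <+> E) + p"
  proof (cases "p \<le> card Y")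
    case True
    define I0 where "I0 = (\<lambda>l. l div d * d) ` {..<card Y}"
    have "I0 \<subseteq> (\<lambda>q. q * d) ` {..<p}"
    proof
      fix i assume "i \<in> I0"
      then obtain l where l: "l < card Y" "i = l div d * d" by (auto simp: I0_def)
      then have "l < p * d" using p by (simp add: d_def)
      then have "l div d \<in> {..<p}" by (simp add: less_mult_imp_div_less)
      then show "i \<in> (\<lambda>q. q * d) ` {..<p}" using l(2) by (rule rev_image_eqI)
    qed
    then have "card I0 \<le> p" using surj_card_le[of "{..<p}"] by simp
    moreover have "I0 \<subseteq> {..<card Y}" 
      by (auto simp: I0_def intro: le_less_trans[OF div_times_less_eq_dividend])
    ultimately obtain I where I: "I0 \<subseteq> I" "I \<subseteq> {..<card Y}" "card I = p"
      using exists_subset_between[of I0 p "{..<card Y}"] True by auto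
    have "l div d * d \<in> I" if "l \<in> {..<card Y}" for l using that I(1) by (auto simp: I0_def)
    then show ?thesis
      using chromatic_number_le_shifts[of I "{..<card Y}" "\<lambda>l. l div d * d" a] assms(1) I h ones
      by simp
  next
    case False
    then have "p = card Y + 1" using assms(6) by simp
    then show ?thesis
      using chromatic_number_le_all_shifts[of "{..<card Y}" "\<lambda>l. l div d * d" a] assms(1) h ones
      by simp
  qed
  moreover have "card (V <+> E) + p \<le> packing_total_chromatic_number a V E + p * card X + card Y"
    using chromatic_number_lower_bounds(2)[of a p] assms by simp
  ultimately show ?thesis by simp
qed

lemma chromatic_number_no_ones:
  assumes "\<And>i. i \<ge> 1 \<Longrightarrow> a i \<ge> 2"
  shows "packing_total_chromatic_number a V E = card (V <+> E)"
proof (rule antisym)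
  obtain c where "packing_total_coloring a V E (card (V <+> E)) c"
    using packing_total_coloring_exists[of V E a] finite_elements
    unfolding finite_Plus_iff by blast
  then show "packing_total_chromatic_number a V E \<le> card (V <+> E)" by (rule chromatic_number_le)
  obtain c where c: "packing_total_coloring a V E (packing_total_chromatic_number a V E) c"
    by (rule chromatic_number_attained)
  have "card (V <+> E) \<le> (\<Sum>i\<in>{1..packing_total_chromatic_number a V E}. 1)"
    unfolding sum_color_classes[OF c]
    by (intro sum_mono packing_class_card_le_1[OF c]) (use assms in auto)
  then show "card (V <+> E) \<le> packing_total_chromatic_number a V E" by simp
qed

end

theorem theorem7:
  fixes a :: "nat \<Rightarrow> nat" and V :: "'a set" and E :: "'a set set"
    and m n :: nat and D :: real
  assumes "packing_seq a"
    and "1 \<le> m" and "m \<le> n"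
    and "complete_bipartite V E m n"
    and "m < n \<Longrightarrow> D = real n / (real n - real m)"
  shows "(\<forall>p. 1 \<le> p \<and> p \<le> n + 1 \<and> (\<forall>i\<in>{1..p}. a i = 1) \<and> a (p + 1) \<ge> 2 \<longrightarrow>
            int (packing_total_chromatic_number a V E) =
              (if m = n then 2 * int m + (int m)\<^sup>2 - int p * (int m - 1)
               else if real p \<le> D then int m + int n + int m * int n - int p * (int n - 1)
               else int m + int m * int n - int p * (int m - 1)))
       \<and> (a 1 \<ge> 2 \<longrightarrow> packing_total_chromatic_number a V E = m + n + m * n)"
proof -
  obtain X Y where XY: "finite X" "finite Y" "card X = m" "card Y = n" "X \<inter> Y = {}"
    "V = X \<union> Y" "E = {{x, y} | x y. x \<in> X \<and> y \<in> Y}"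
    using assms(4) unfolding complete_bipartite_def by blast
  interpret complete_bipartition X Y V E
    by unfold_locales (use XY assms(2,3) in auto)
  note N = card_elements[unfolded XY(3,4)]
  have pos: "a i \<ge> 1" if "i \<ge> 1" for i
    using assms(1) that by (simp add: packing_seq_def Suc_le_eq)
  have mono: "a i \<le> a j" if "1 \<le> i" "i \<le> j" for i j
    using assms(1) that by (intro mono_onD[of "{1..}" a]) (auto simp: packing_seq_def)
  show ?thesis
  proof (intro conjI allI impI)
    fix p assume p: "1 \<le> p \<and> p \<le> n + 1 \<and> (\<forall>i\<in>{1..p}. a i = 1) \<and> a (p + 1) \<ge> 2"
    have ones: "a i = 1" if "i \<in> {1..p}" for i using p that by blast
    have large: "a i \<ge> 2" if "i > p" for i using p mono[of "p + 1" i] that by simp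
    let ?k = "packing_total_chromatic_number a V E"
    have D: "real p \<le> D \<longleftrightarrow> p * (n - m) \<le> n" if "m < n"
    proof -
      have "real p \<le> D \<longleftrightarrow> real p * (real n - real m) \<le> real n"
        using assms(5)[OF that] that by (simp add: pos_le_divide_eq)
      also have "\<dots> \<longleftrightarrow> real (p * (n - m)) \<le> real n" using that by (simp add: of_nat_diff)
      finally show ?thesis by (simp only: of_nat_le_iff)
    qed
    consider "m = n" | "m < n" "p * (n - m) \<le> n" | "m < n" "n < p * (n - m)"
      using assms(3) by linarith
    then show "int ?k =
              (if m = n then 2 * int m + (int m)\<^sup>2 - int p * (int m - 1)
               else if real p \<le> D then int m + int n + int m * int n - int p * (int n - 1)
               else int m + int m * int n - int p * (int m - 1))"
    proof cases
      case 1
      have "?k + p * m = m + n + m * n + p"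
        using chromatic_number_balanced[of a p] 1 pos large ones p XY N by simp
      then have "int (?k + p * m) = int (m + n + m * n + p)" by (rule arg_cong)
      then show ?thesis using 1 by (simp add: algebra_simps power2_eq_square)
    next
      case 2
      have "?k + p * n = m + n + m * n + p"
        using chromatic_number_few_ones[of a p] 2 pos large ones p XY N by simp
      then have "int (?k + p * n) = int (m + n + m * n + p)" by (rule arg_cong)
      then show ?thesis using 2 D by (simp add: algebra_simps)
    next
      case 3
      have "?k + p * m + n = m + n + m * n + p"
        using chromatic_number_many_ones[of a p] 3 pos large ones p XY N by simp
      then have "int (?k + p * m + n) = int (m + n + m * n + p)" by (rule arg_cong)
      then show ?thesis using 3 D by (simp add: algebra_simps)
    qed
  next
    assume "a 1 \<ge> 2"
    then have "a i \<ge> 2" if "i \<ge> 1" for i using mono[of 1 i] that by simp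
    then show "packing_total_chromatic_number a V E = m + n + m * n"
      using chromatic_number_no_ones[of a] N by simp
  qed
qed

end
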